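(* Let $\omega_1,\omega_2$ be non-zero complex numbers with $\mathrm{Im}(\omega_2/\omega_1)>0$, and let $\tilde\wp_{\omega_1,\omega_2}$ be the modified Weierstrass function. Then: (1) for $|\mathrm{Im}(z/\omega_1)|<\tfrac12\mathrm{Im}(\omega_2/\omega_1)$, $$\tilde\wp_{\omega_1,\omega_2}(z)=-\frac{4i\pi^2}{\omega_1^2}\left(\sum_{n=1}^{+\infty}\frac{(-1)^n n}{\sin(n\pi\omega_2/\omega_1)}\cos\left(2n\pi\frac{z}{\omega_1}\right)-\sum_{n=1}^{+\infty}\frac{(-1)^n n}{\sin(n\pi\omega_2/\omega_1)}\right);$$ (2) for $|\mathrm{Im}(z/\omega_2)|<-\tfrac12\mathrm{Im}(\omega_1/\omega_2)$, $$\tilde\wp_{\omega_1,\omega_2}(z)=\frac{4i\pi^2}{\omega_2^2}\left(\sum_{n=1}^{+\infty}\frac{(-1)^n n}{\sin(n\pi\omega_1/\omega_2)}\cos\left(2n\pi\frac{z}{\omega_2}\right)-\sum_{n=1}^{+\infty}\frac{(-1)^n n}{\sin(n\pi\omega_1/\omega_2)}\right);$$ (3) for $z\in\mathbb{C}\setminus\Lambda^\star_{\omega_1,\omega_2}$, $$\tilde\wp_{\omega_1,\omega_2}(z)=\frac{\pi^2}{\omega_1^2}\sum_{n\in\mathbb{Z}}\left(\frac{1}{\sin((z-\omega_0-\omega_2n)\pi/\omega_1)^2}-\frac{1}{\sin((\omega_0+\omega_2n)\pi/\omega_1)^2}\right);$$ (4) for $z\in\mathbb{C}\setminus\Lambda^\star_{\omega_1,\omega_2}$,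 $$\tilde\wp_{\omega_1,\omega_2}(z)=\frac{\pi^2}{\omega_2^2}\sum_{n\in\mathbb{Z}}\left(\frac{1}{\sin((z-\omega_0-\omega_1n)\pi/\omega_2)^2}-\frac{1}{\sin((\omega_0+\omega_1n)\pi/\omega_2)^2}\right).$$
   Context: Put $\omega_0=\frac{\omega_1+\omega_2}{2}$, $\Lambda_{\omega_1,\omega_2}=\omega_1\mathbb{Z}+\omega_2\mathbb{Z}$ and $\Lambda^\star_{\omega_1,\omega_2}=\omega_0+\Lambda_{\omega_1,\omega_2}$. The modified Weierstrass function is the meromorphic function on $\mathbb{C}$ $$\tilde\wp_{\omega_1,\omega_2}(z)=\sum_{a\in\Lambda^\star_{\omega_1,\omega_2}}\left(\frac{1}{(z-a)^2}-\frac{1}{a^2}\right),$$ so that $\tilde\wp_{\omega_1,\omega_2}(z)=\wp_{\omega_1,\omega_2}(z+\omega_0)-\wp_{\omega_1,\omega_2}(\omega_0)$ with $\wp_{\omega_1,\omega_2}$ the usual Weierstrass function of the lattice $\Lambda_{\omega_1,\omega_2}$. *)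

theory Defs
  imports "HOL-Analysis.Analysis"
begin

definition half_period :: "complex \<Rightarrow> complex \<Rightarrow> complex" where
  "half_period \<omega>1 \<omega>2 = (\<omega>1 + \<omega>2) / 2"

definition period_lattice :: "complex \<Rightarrow> complex \<Rightarrow> complex set" where
  "period_lattice \<omega>1 \<omega>2 = {of_int m * \<omega>1 + of_int n * \<omega>2 | m n. True}"

definition shifted_lattice :: "complex \<Rightarrow> complex \<Rightarrow> complex set" where
  "shifted_lattice \<omega>1 \<omega>2 = (\<lambda>a. half_period \<omega>1 \<omega>2 + a) ` period_lattice \<omega>1 \<omega>2"

(* The value is meaningful only away from the poles, i.e. for z outside
   shifted_lattice: at a pole z = a the convention 1 / 0 = 0 makes the
   value of the sum an arbitrary finite number. *)
definition modified_weierstrass :: "complex \<Rightarrow> complex \<Rightarrow> complex \<Rightarrow> complex" where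
  "modified_weierstrass \<omega>1 \<omega>2 z =
     (\<Sum>\<^sub>\<infinity>a\<in>shifted_lattice \<omega>1 \<omega>2. 1 / (z - a)\<^sup>2 - 1 / a\<^sup>2)"

end

(* Summing over the rows of the shifted lattice with the partial fraction expansion of
   1 / sin^2 (differentiate the reflection formula of the Gamma function logarithmically, twice)
   gives (3); absolute convergence holds because 1 / |a|^3 is summable over the lattice, as
   |a| >= c (x + y) for the half-integer coordinates and (x + y)^3 >= x^(3/2) y^(3/2).
   In the strip of (1) the two terms of each row are separately summable: expanding
   1 / sin^2 in powers of exp (2 pi i w) and exchanging the two sums yields the Fourier series.
   (4) and (2) are (3) and (1) for the bases (w2, w1) and (w2, -w1), which have the same
   shifted lattice. *)

theory Submission imports Defs begin


section \<open>Partial fraction expansion of 1 / sin^2\<close>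

text \<open>The maps k and - k - 1 on the naturals partition the integers. The offset in - k - 1
  fits the symmetries used later: w to 1 - w for the trigamma series, and m + 1/2 to - (m + 1/2) for
  half-integers.\<close>

lemma has_sum_int_split:
  fixes f :: "int \<Rightarrow> 'a :: {topological_comm_monoid_add, t2_space}"
  assumes "((\<lambda>k::nat. f (int k)) has_sum A) UNIV" "((\<lambda>k::nat. f (- int k - 1)) has_sum B) UNIV"
  shows "(f has_sum (A + B)) UNIV"
proof -
  have "(f has_sum A) (range int)"
    using assms(1) by (subst has_sum_reindex) (auto simp: o_def)
  moreover have "(f has_sum B) (range (\<lambda>k. - int k - 1))"
    using assms(2) by (subst has_sum_reindex) (auto simp: o_def inj_on_def)
  moreover have "range int \<inter> range (\<lambda>k. - int k - 1) = {}"
    by auto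
  ultimately have "(f has_sum (A + B)) (range int \<union> range (\<lambda>k. - int k - 1))"
    by (rule has_sum_Un_disjoint)
  moreover have "x \<in> range int \<union> range (\<lambda>k. - int k - 1)" for x
  proof (cases "x \<ge> 0")
    case True
    then have "x = int (nat x)" by simp
    then show ?thesis by blast
  next
    case False
    then have "x = - int (nat (- x - 1)) - 1" by simp
    then show ?thesis by blast
  qed
  ultimately show ?thesis
    by (metis UNIV_eq_I)
qed

lemma sin_pi_eq_0_imp_Ints:
  fixes w :: complex
  assumes "sin (of_real pi * w) = 0"
  shows "w \<in> \<int>"
proof -
  obtain n :: int where "of_real pi * w = of_real (of_int n * pi)"
    using assms unfolding sin_eq_0 by (auto simp: mult.commute)
  then have "w = of_int n" by simp
  then show ?thesis by simp
qed

text \<open>Logarithmic derivative of Gamma(z) Gamma(1 - z) = pi / sin(pi z): both sides are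
  differentiated, and the common factor \<open>?G\<close>, which has no zeros, is cancelled.\<close>

lemma Digamma_reflection_complex:
  fixes z :: complex
  assumes "z \<notin> \<int>"
  shows "Digamma z - Digamma (1 - z) = - (of_real pi * cot (of_real pi * z))"
proof -
  have z: "z \<notin> \<int>\<^sub>\<le>\<^sub>0" "1 - z \<notin> \<int>\<^sub>\<le>\<^sub>0"
    using assms nonpos_Ints_Int Ints_diff[OF Ints_1, of "1 - z"] by auto
  have s: "sin (of_real pi * z) \<noteq> 0"
    using assms sin_pi_eq_0_imp_Ints by blast
  let ?G = "Gamma z * Gamma (1 - z)"
  have "((\<lambda>z. Gamma z * Gamma (1 - z)) has_field_derivative ?G * (Digamma z - Digamma (1 - z))) (at z)"
    using z by (auto intro!: derivative_eq_intros simp: algebra_simps)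
  moreover have "((\<lambda>z. of_real pi / sin (of_real pi * z)) has_field_derivative
     ?G * - (of_real pi * cot (of_real pi * z))) (at z)"
    using s unfolding Gamma_reflection_complex
    by (auto intro!: derivative_eq_intros simp: cot_def field_simps power2_eq_square)
  ultimately have "?G * (Digamma z - Digamma (1 - z)) = ?G * - (of_real pi * cot (of_real pi * z))"
    unfolding Gamma_reflection_complex by (rule DERIV_unique)
  moreover have "?G \<noteq> 0"
    using s by (simp add: Gamma_reflection_complex)
  ultimately show ?thesis by (metis mult_left_cancel)
qed

text \<open>Derivative of the digamma reflection formula; the inner derivative of 1 - z turns the
  difference into a sum.\<close>

lemma Trigamma_reflection_complex:
  fixes z :: complex
  assumes "z \<notin> \<int>"
  shows "Polygamma 1 z + Polygamma 1 (1 - z) = (of_real pi)\<^sup>2 / (sin (of_real pi * z))\<^sup>2"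
proof -
  have z: "z \<notin> \<int>\<^sub>\<le>\<^sub>0" "1 - z \<notin> \<int>\<^sub>\<le>\<^sub>0"
    using assms nonpos_Ints_Int Ints_diff[OF Ints_1, of "1 - z"] by auto
  have s: "sin (of_real pi * z) \<noteq> 0"
    using assms sin_pi_eq_0_imp_Ints by blast
  have "((\<lambda>z. Digamma z - Digamma (1 - z)) has_field_derivative Polygamma 1 z + Polygamma 1 (1 - z)) (at z)"
    using z by (auto intro!: derivative_eq_intros)
  moreover have "((\<lambda>z. - (of_real pi * cot (of_real pi * z))) has_field_derivative
     (of_real pi)\<^sup>2 / (sin (of_real pi * z))\<^sup>2) (at z)"
    using s by (auto intro!: derivative_eq_intros DERIV_chain2[OF DERIV_cot]
        simp: field_simps power2_eq_square)
  then have "((\<lambda>z. Digamma z - Digamma (1 - z)) has_field_derivative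
     (of_real pi)\<^sup>2 / (sin (of_real pi * z))\<^sup>2) (at z)"
    \<comment> \<open>The digamma formula is available off the integers, an open set around z, so
      derivatives at z agree.\<close>
    by (rule has_field_derivative_transform_within_open[where S = "- \<int>"])
       (use assms in \<open>auto simp: Digamma_reflection_complex\<close>)
  ultimately show ?thesis by (rule DERIV_unique)
qed

text \<open>The defining series of \<open>Polygamma 1\<close>, upgraded from \<open>sums\<close> to
  \<open>has_sum\<close> by absolute convergence: for k \<ge> 2 |z| one has |z + k| \<ge> k / 2,
  hence the majorant 4 / k^2.\<close>

lemma has_sum_Trigamma:
  fixes z :: complex
  assumes "z \<noteq> 0"
  shows "((\<lambda>k::nat. 1 / (z + of_nat k)\<^sup>2) has_sum Polygamma 1 z) UNIV"
proof (rule norm_summable_imp_has_sum)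
  show "(\<lambda>k. 1 / (z + of_nat k)\<^sup>2) sums Polygamma 1 z"
    using Polygamma_LIMSEQ[of z 1] assms by (simp add: power2_eq_square field_simps)
  show "summable (\<lambda>k. norm (1 / (z + of_nat k)\<^sup>2))"
  proof (rule summable_comparison_test_ev)
    show "summable (\<lambda>k. 4 * inverse (real k ^ 2))"
      by (intro summable_mult inverse_power_summable) auto
    show "\<forall>\<^sub>F k in sequentially. norm (norm (1 / (z + of_nat k)\<^sup>2)) \<le> 4 * inverse (real k ^ 2)"
      using eventually_ge_at_top[of "nat \<lceil>2 * norm z\<rceil> + 1"]
    proof eventually_elim
      case (elim k)
      then have k: "real k \<ge> 2 * norm z" "k > 0" by linarith+
      have "real k \<le> norm (z + of_nat k) + norm z"
        by (metis add_diff_cancel_left' norm_of_nat norm_triangle_ineq4)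
      then have "real k / 2 \<le> norm (z + of_nat k)" using k by simp
      then have "(real k / 2)\<^sup>2 \<le> (norm (z + of_nat k))\<^sup>2"
        by (intro power_mono) auto
      then have "1 / (norm (z + of_nat k))\<^sup>2 \<le> 1 / (real k / 2)\<^sup>2"
        using k by (intro divide_left_mono) (auto intro!: mult_pos_pos)
      then show ?case
        by (simp add: norm_divide norm_power power_divide divide_simps)
    qed
  qed
qed

text \<open>Since (w - k - 1)^2 = (1 - w + k)^2, the nonnegative and the negative indices give
  trigamma series at w and at 1 - w, which the reflection formula adds up.\<close>

lemma has_sum_csc_squared:
  fixes w :: complex
  assumes "w \<notin> \<int>"
  shows "((\<lambda>m::int. 1 / (w + of_int m)\<^sup>2) has_sum (of_real pi)\<^sup>2 / (sin (of_real pi * w))\<^sup>2) UNIV"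
proof -
  have "w \<noteq> 0" "1 - w \<noteq> 0" using assms by auto
  have "((\<lambda>k::nat. 1 / (w + of_int (int k))\<^sup>2) has_sum Polygamma 1 w) UNIV"
    using has_sum_Trigamma[OF \<open>w \<noteq> 0\<close>] by simp
  moreover have "(w + of_int (- int k - 1))\<^sup>2 = (1 - w + of_nat k)\<^sup>2" for k
    by (simp add: power2_eq_square algebra_simps)
  then have "((\<lambda>k::nat. 1 / (w + of_int (- int k - 1))\<^sup>2) has_sum Polygamma 1 (1 - w)) UNIV"
    using has_sum_Trigamma[OF \<open>1 - w \<noteq> 0\<close>] by presburger
  ultimately show ?thesis
    using has_sum_int_split[of "\<lambda>m. 1 / (w + of_int m)\<^sup>2"] Trigamma_reflection_complex[OF assms]
    by metis
qed

lemma has_sum_csc_squared_scaled: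
  fixes x \<omega> :: complex
  assumes "x / \<omega> \<notin> \<int>"
  shows "((\<lambda>m::int. 1 / (x + of_int m * \<omega>)\<^sup>2) has_sum
           (of_real pi)\<^sup>2 / \<omega>\<^sup>2 * (1 / (sin (x * of_real pi / \<omega>))\<^sup>2)) UNIV"
proof -
  have "\<omega> \<noteq> 0" using assms by auto
  then have "1 / (x + of_int m * \<omega>)\<^sup>2 = 1 / \<omega>\<^sup>2 * (1 / (x / \<omega> + of_int m)\<^sup>2)" for m
    by (simp add: field_simps flip: power_mult_distrib)
  then show ?thesis
    using has_sum_cmult_right[OF has_sum_csc_squared[OF assms], of "1 / \<omega>\<^sup>2"]
    by (simp add: mult.commute)
qed

section \<open>Majorants and norm estimates\<close>

lemma summable_on_Times_mult_real:
  fixes f :: "'a \<Rightarrow> real" and g :: "'b \<Rightarrow> real"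
  assumes "f summable_on A" "g summable_on B" "\<And>x. x \<in> A \<Longrightarrow> f x \<ge> 0" "\<And>y. y \<in> B \<Longrightarrow> g y \<ge> 0"
  shows "(\<lambda>(x, y). f x * g y) summable_on (A \<times> B)"
proof (rule summable_on_SigmaI)
  show "((\<lambda>y. case (x, y) of (x, y) \<Rightarrow> f x * g y) has_sum f x * infsum g B) B" for x
    using has_sum_cmult_right[OF has_sum_infsum[OF assms(2)], of "f x"] by simp
  show "(\<lambda>x. f x * infsum g B) summable_on A"
    by (intro summable_on_cmult_left assms)
qed (use assms in auto)

text \<open>After division by \<open>\<omega>1\<close> the imaginary part controls y, and then the
  triangle inequality controls x. Real coordinates are allowed so that the bound covers both
  half-integer points and differences of points.\<close>

lemma lattice_norm_lower_bound:
  fixes \<omega>1 \<omega>2 :: complex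
  assumes "Im (\<omega>2 / \<omega>1) \<noteq> 0"
  obtains c where "c > 0"
    "\<And>x y :: real. c * (\<bar>x\<bar> + \<bar>y\<bar>) \<le> norm (of_real x * \<omega>1 + of_real y * \<omega>2)"
proof -
  define \<tau> where "\<tau> = \<omega>2 / \<omega>1"
  have w1: "\<omega>1 \<noteq> 0" using assms by auto
  define b where "b = \<bar>Im \<tau>\<bar>"
  have b: "b > 0" using assms by (simp add: b_def \<tau>_def)
  \<comment> \<open>From |x| + |y| \<le> N + |y| (|\<tau>| + 1) and |y| \<le> N / b, with N the norm
    of x + y \<tau>.\<close>
  define K where "K = 1 + (norm \<tau> + 1) / b"
  have K: "K > 0" using b by (simp add: K_def add_pos_nonneg)
  have *: "\<bar>x\<bar> + \<bar>y\<bar> \<le> K * norm (of_real x + of_real y * \<tau>)" for x y :: real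
  proof -
    let ?N = "norm (of_real x + of_real y * \<tau>)"
    have "\<bar>y\<bar> * b = \<bar>Im (of_real x + of_real y * \<tau>)\<bar>"
      by (simp add: b_def abs_mult)
    also have "\<dots> \<le> ?N" by (rule abs_Im_le_cmod)
    finally have y: "\<bar>y\<bar> \<le> ?N / b" using b by (simp add: field_simps)
    have "\<bar>x\<bar> \<le> ?N + \<bar>y\<bar> * norm \<tau>"
      using norm_triangle_ineq4[of "of_real x + of_real y * \<tau>" "of_real y * \<tau>"] by (simp add: norm_mult)
    then have "\<bar>x\<bar> + \<bar>y\<bar> \<le> ?N + \<bar>y\<bar> * (norm \<tau> + 1)" by (simp add: algebra_simps)
    also have "\<dots> \<le> ?N + ?N / b * (norm \<tau> + 1)"
      using y by (intro add_left_mono mult_right_mono) auto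
    also have "\<dots> = K * ?N" using b by (simp add: K_def field_simps)
    finally show ?thesis .
  qed
  show ?thesis
  proof
    show "norm \<omega>1 / K > 0" using w1 K by simp
    fix x y :: real
    have "norm \<omega>1 / K * (\<bar>x\<bar> + \<bar>y\<bar>) \<le> norm \<omega>1 / K * (K * norm (of_real x + of_real y * \<tau>))"
      using * K by (intro mult_left_mono) auto
    also have "\<dots> = norm (\<omega>1 * (of_real x + of_real y * \<tau>))"
      using K by (simp add: norm_mult)
    also have "\<omega>1 * (of_real x + of_real y * \<tau>) = of_real x * \<omega>1 + of_real y * \<omega>2"
      using w1 by (simp add: \<tau>_def field_simps)
    finally show "norm \<omega>1 / K * (\<bar>x\<bar> + \<bar>y\<bar>) \<le> norm (of_real x * \<omega>1 + of_real y * \<omega>2)" .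
  qed
qed

text \<open>One factor of the lattice majorant: the exponent is half of 3 and still exceeds 1. The
  indices k and - k - 1 give equal terms, so one series over the naturals serves for both
  halves.\<close>

lemma summable_on_half_integer_powr:
  "(\<lambda>m::int. \<bar>of_int m + 1 / 2\<bar> powr - (3 / 2) :: real) summable_on UNIV"
proof -
  have "(\<lambda>k::nat. (real k + 1 / 2) powr - (3 / 2)) summable_on UNIV"
  proof (subst summable_on_UNIV_nonneg_real_iff)
    show "summable (\<lambda>k. (real k + 1 / 2) powr - (3 / 2))"
    proof (rule summable_comparison_test_ev)
      show "summable (\<lambda>k. real k powr - (3 / 2))"
        by (simp add: summable_real_powr_iff)
      \<comment> \<open>The comparison fails at k = 0, where \<open>0 powr - (3 / 2)\<close> is 0 by
        convention.\<close>
      show "\<forall>\<^sub>F k in sequentially. norm ((real k + 1 / 2) powr - (3 / 2)) \<le> real k powr - (3 / 2)"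
        using eventually_gt_at_top[of 0] by eventually_elim (auto intro!: powr_mono2')
    qed
  qed auto
  then obtain S where S: "((\<lambda>k::nat. (real k + 1 / 2) powr - (3 / 2)) has_sum S) UNIV"
    by (auto simp: summable_on_def)
  have "\<bar>of_int (- int k - 1) + 1 / 2\<bar> = real k + 1 / 2" "\<bar>of_int (int k) + 1 / 2\<bar> = real k + 1 / 2" for k
    by simp_all
  then show ?thesis
    using has_sum_int_split[of "\<lambda>m. \<bar>of_int m + 1 / 2\<bar> powr - (3 / 2)" S S] S
    by (metis (no_types, lifting) has_sum_cong has_sum_imp_summable)
qed


text \<open>The pair has the row index n first, so that a sum over pairs can be iterated with m, the
  multiple of \<open>\<omega>1\<close>, running inside a row.\<close>

lemma shifted_lattice_alt:
  "shifted_lattice \<omega>1 \<omega>2 =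
     range (\<lambda>(n, m). half_period \<omega>1 \<omega>2 + of_int n * \<omega>2 + of_int m * \<omega>1)"
proof -
  have "period_lattice \<omega>1 \<omega>2 = range (\<lambda>(n, m). of_int n * \<omega>2 + of_int m * \<omega>1)"
    unfolding period_lattice_def by (auto simp: image_def) (metis add.commute)+
  then show ?thesis
    by (auto simp: shifted_lattice_def image_iff add.assoc)
qed

lemma shifted_lattice_point:
  "half_period \<omega>1 \<omega>2 + of_int n * \<omega>2 + of_int m * \<omega>1 =
     of_real (of_int m + 1 / 2) * \<omega>1 + of_real (of_int n + 1 / 2) * \<omega>2"
  by (simp add: half_period_def algebra_simps add_divide_distrib)

lemma mem_shifted_lattice_iff:
  "x \<in> shifted_lattice \<omega>1 \<omega>2 \<longleftrightarrow>
     (\<exists>m n :: int. x = of_real (of_int m + 1 / 2) * \<omega>1 + of_real (of_int n + 1 / 2) * \<omega>2)"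
  unfolding shifted_lattice_alt image_iff Bex_def split_paired_Ex prod.case shifted_lattice_point
  by blast

text \<open>The difference equals z (2 a - z) / ((z - a)^2 a^2). The numerator is at most 5/2 |z|
  |a| and the denominator at least |a|^4 / 4, whence the constant 10.\<close>

lemma norm_diff_inverse_squares_le:
  fixes z a :: complex
  assumes "2 * norm z \<le> norm a" "a \<noteq> 0"
  shows "norm (1 / (z - a)\<^sup>2 - 1 / a\<^sup>2) \<le> 10 * norm z / norm a ^ 3"
proof -
  have a: "norm a > 0" using assms by simp
  have za: "norm (z - a) \<ge> norm a / 2"
    using norm_triangle_ineq2[of a z] assms(1) by (simp add: norm_minus_commute)
  then have "z - a \<noteq> 0" using a by force
  then have "1 / (z - a)\<^sup>2 - 1 / a\<^sup>2 = z * (2 * a - z) / ((z - a)\<^sup>2 * a\<^sup>2)"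
    using assms(2) by (simp add: divide_simps) (simp add: power2_eq_square algebra_simps)
  then have "norm (1 / (z - a)\<^sup>2 - 1 / a\<^sup>2) = norm z * norm (2 * a - z) / ((norm (z - a))\<^sup>2 * (norm a)\<^sup>2)"
    by (simp add: norm_mult norm_divide norm_power)
  also have "\<dots> \<le> norm z * (5 / 2 * norm a) / ((norm a / 2)\<^sup>2 * (norm a)\<^sup>2)"
  proof (rule frac_le)
    show "norm z * norm (2 * a - z) \<le> norm z * (5 / 2 * norm a)"
      using norm_triangle_ineq4[of "2 * a" z] assms(1) by (intro mult_left_mono) (auto simp: norm_mult)
    show "(norm a / 2)\<^sup>2 * (norm a)\<^sup>2 \<le> (norm (z - a))\<^sup>2 * (norm a)\<^sup>2"
      using za by (intro mult_right_mono power_mono) auto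
  qed (use a in auto)
  also have "\<dots> = 10 * norm z / norm a ^ 3"
    using a by (simp add: power2_eq_square power3_eq_cube field_simps)
  finally show ?thesis .
qed

section \<open>Absolute convergence over the lattice and summation by rows\<close>

context
  fixes \<omega>1 \<omega>2 :: complex
  assumes indep: "Im (\<omega>2 / \<omega>1) \<noteq> 0"
begin

text \<open>The difference of two equal points has coordinates m - m' and n - n', which the norm
  bound forces to vanish.\<close>

lemma inj_shifted_lattice_point:
  "inj (\<lambda>(n, m). half_period \<omega>1 \<omega>2 + of_int n * \<omega>2 + of_int m * \<omega>1)"
proof (rule injI, clarify)
  fix n m n' m' :: int
  assume eq: "half_period \<omega>1 \<omega>2 + of_int n * \<omega>2 + of_int m * \<omega>1 =
    half_period \<omega>1 \<omega>2 + of_int n' * \<omega>2 + of_int m' * \<omega>1"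
  obtain c where c: "c > 0"
    "\<And>x y :: real. c * (\<bar>x\<bar> + \<bar>y\<bar>) \<le> norm (of_real x * \<omega>1 + of_real y * \<omega>2)"
    using lattice_norm_lower_bound[OF indep] by blast
  have "of_real (of_int (m - m')) * \<omega>1 + of_real (of_int (n - n')) * \<omega>2 = 0"
    using eq by (simp add: algebra_simps)
  then have "c * (\<bar>of_int (m - m')\<bar> + \<bar>of_int (n - n')\<bar>) \<le> 0"
    using c(2)[of "of_int (m - m')" "of_int (n - n')"] by simp
  then have "real_of_int \<bar>m - m'\<bar> + real_of_int \<bar>n - n'\<bar> \<le> 0"
    using c(1) by (simp add: mult_le_0_iff)
  then show "n = n' \<and> m = m'" by linarith
qed

text \<open>All but finitely many terms satisfy |a| \<ge> 2 |z| and are dominated by a constant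
  times a product of a function of n and a function of m.\<close>

lemma summable_on_shifted_lattice:
  "(\<lambda>(n, m). 1 / (z - (half_period \<omega>1 \<omega>2 + of_int n * \<omega>2 + of_int m * \<omega>1))\<^sup>2
      - 1 / (half_period \<omega>1 \<omega>2 + of_int n * \<omega>2 + of_int m * \<omega>1)\<^sup>2) summable_on UNIV"
proof -
  define a where "a = (\<lambda>(n::int, m::int). half_period \<omega>1 \<omega>2 + of_int n * \<omega>2 + of_int m * \<omega>1)"
  define X :: "int \<Rightarrow> real" where "X m = \<bar>of_int m + 1 / 2\<bar>" for m
  obtain c where c: "c > 0"
    "\<And>x y :: real. c * (\<bar>x\<bar> + \<bar>y\<bar>) \<le> norm (of_real x * \<omega>1 + of_real y * \<omega>2)"
    using lattice_norm_lower_bound[OF indep] by blast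
  have X: "X m > 0" for m :: int
  proof -
    have "real_of_int m \<noteq> - (1 / 2)"
    proof
      assume "real_of_int m = - (1 / 2)"
      then have "real_of_int (2 * m + 1) = real_of_int 0" by simp
      then have "2 * m + 1 = 0" by (simp only: of_int_eq_iff)
      then show False by presburger
    qed
    then show ?thesis by (simp add: X_def)
  qed
  have a_ge: "c * (X m + X n) \<le> norm (a (n, m))" for n m
    using c(2)[of "of_int m + 1 / 2" "of_int n + 1 / 2"]
    by (simp only: a_def X_def shifted_lattice_point prod.case)
  have a_pos: "norm (a (n, m)) > 0" for n m
    using a_ge[of m n] c(1) X[of m] X[of n] by (smt (verit) mult_pos_pos)
  define B where "B = (\<lambda>(n, m). 10 * norm z / c ^ 3 * (X n powr - (3 / 2) * X m powr - (3 / 2)))"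
  \<comment> \<open>The points too close for \<open>norm_diff_inverse_squares_le\<close>; z itself
    is among them when it is a pole.\<close>
  define F where "F = {p. norm (a p) < 2 * norm z}"
  define f where "f p = 1 / (z - a p)\<^sup>2 - 1 / (a p)\<^sup>2" for p
  have "finite F"
  proof -
    \<comment> \<open>The extra 1 absorbs the shift by 1/2 in \<open>X\<close>.\<close>
    define K where "K = \<lceil>2 * norm z / c\<rceil> + 1"
    have "F \<subseteq> {- K..K} \<times> {- K..K}"
    proof safe
      fix n m assume "(n, m) \<in> F"
      then have "c * (X m + X n) < 2 * norm z"
        using a_ge[of m n] by (simp add: F_def)
      then have "X m + X n < 2 * norm z / c"
        using c(1) by (simp add: field_simps)
      then have "X n < 2 * norm z / c" "X m < 2 * norm z / c"
        using X[of m] X[of n] by linarith+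
      then show "n \<in> {- K..K}" "m \<in> {- K..K}"
        unfolding K_def X_def by (simp_all, linarith+)
    qed
    then show ?thesis by (rule finite_subset) auto
  qed
  have "(\<lambda>(n, m). X n powr - (3 / 2) * X m powr - (3 / 2)) summable_on UNIV \<times> UNIV"
    unfolding X_def
    by (intro summable_on_Times_mult_real summable_on_half_integer_powr) auto
  then have "B summable_on UNIV"
    using summable_on_cmult_right[of _ UNIV "10 * norm z / c ^ 3"]
    by (simp add: B_def case_prod_unfold)
  then have "B summable_on - F"
    by (rule summable_on_subset_banach) auto
  moreover have "norm (f p) \<le> B p" if "p \<in> - F" for p
  proof (cases p)
    case (Pair n m)
    have N: "norm (a p) \<ge> 2 * norm z" using that by (simp add: F_def)
    have "norm (f p) \<le> 10 * norm z / norm (a p) ^ 3"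
      unfolding f_def using N a_pos[of n m] Pair by (intro norm_diff_inverse_squares_le) auto
    also have "\<dots> \<le> 10 * norm z / (c ^ 3 * (X n powr (3 / 2) * X m powr (3 / 2)))"
    proof (rule divide_left_mono)
      \<comment> \<open>The cube of \<open>X m + X n\<close> is split into two equal powers, each of
        which dominates one of the summands.\<close>
      have "X n powr (3 / 2) * X m powr (3 / 2) \<le> (X m + X n) powr (3 / 2) * (X m + X n) powr (3 / 2)"
        using X[of m] X[of n] by (intro mult_mono powr_mono2) auto
      also have "\<dots> = (X m + X n) ^ 3"
        using X[of m] X[of n] by (simp flip: powr_add powr_numeral)
      finally have "c ^ 3 * (X n powr (3 / 2) * X m powr (3 / 2)) \<le> (c * (X m + X n)) ^ 3"
        using c(1) by (simp add: power_mult_distrib)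
      also have "\<dots> \<le> norm (a p) ^ 3"
        using a_ge[of m n] c(1) X[of m] X[of n] Pair by (intro power_mono) auto
      finally show "c ^ 3 * (X n powr (3 / 2) * X m powr (3 / 2)) \<le> norm (a p) ^ 3" .
      show "0 < norm (a p) ^ 3 * (c ^ 3 * (X n powr (3 / 2) * X m powr (3 / 2)))"
        using a_pos[of n m] c(1) X[of m] X[of n] Pair by (intro mult_pos_pos) auto
    qed auto
    also have "\<dots> = B p"
      using Pair by (simp add: B_def powr_minus field_simps)
    finally show ?thesis .
  qed
  ultimately have "(\<lambda>p. norm (f p)) summable_on - F"
    by (rule summable_on_comparison_test) auto
  then have "f summable_on - F"
    by (rule abs_summable_summable)
  moreover have "f summable_on F"
    using \<open>finite F\<close> by simp
  ultimately have "f summable_on (- F \<union> F)"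
    by (intro summable_on_Un_disjoint) auto
  then show ?thesis
    by (simp add: f_def[abs_def] a_def case_prod_unfold Un_commute)
qed

text \<open>Supplies the hypothesis of \<open>has_sum_csc_squared_scaled\<close> on each row: an
  integer quotient m would make z the lattice point with indices (n, - m).\<close>

lemma half_row_not_Ints:
  assumes "z \<notin> shifted_lattice \<omega>1 \<omega>2"
  shows "(half_period \<omega>1 \<omega>2 + of_int n * \<omega>2 - z) / \<omega>1 \<notin> \<int>"
proof
  assume "(half_period \<omega>1 \<omega>2 + of_int n * \<omega>2 - z) / \<omega>1 \<in> \<int>"
  then obtain m where m: "(half_period \<omega>1 \<omega>2 + of_int n * \<omega>2 - z) / \<omega>1 = of_int m"
    by (auto elim: Ints_cases)
  have "\<omega>1 \<noteq> 0" using indep by auto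
  with m have "z = half_period \<omega>1 \<omega>2 + of_int n * \<omega>2 + of_int (- m) * \<omega>1"
    by (simp add: field_simps)
  then have "z \<in> shifted_lattice \<omega>1 \<omega>2"
    unfolding shifted_lattice_alt by (intro range_eqI[of _ _ "(n, - m)"]) simp
  then show False using assms by contradiction
qed

text \<open>Both coordinates are half-integers, and the norm bound would make them 0, which parity
  forbids. This allows y = 0 in the row formula, giving the terms 1 / a^2.\<close>

lemma zero_notin_shifted_lattice: "0 \<notin> shifted_lattice \<omega>1 \<omega>2"
proof
  assume "0 \<in> shifted_lattice \<omega>1 \<omega>2"
  then obtain n m :: int where nm: "half_period \<omega>1 \<omega>2 + of_int n * \<omega>2 + of_int m * \<omega>1 = 0"
    by (auto simp: shifted_lattice_alt)
  obtain c where c: "c > 0"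
    "\<And>x y :: real. c * (\<bar>x\<bar> + \<bar>y\<bar>) \<le> norm (of_real x * \<omega>1 + of_real y * \<omega>2)"
    using lattice_norm_lower_bound[OF indep] by blast
  have "c * (\<bar>of_int m + 1 / 2\<bar> + \<bar>of_int n + 1 / 2\<bar>) \<le> 0"
    using c(2)[of "of_int m + 1 / 2" "of_int n + 1 / 2"] nm by (simp only: shifted_lattice_point norm_zero)
  then have "real_of_int m = - (1 / 2)"
    using c(1) by (simp add: mult_le_0_iff)
  then have "real_of_int (2 * m + 1) = real_of_int 0" by simp
  then have "2 * m + 1 = 0" by (simp only: of_int_eq_iff)
  then show False by presburger
qed

text \<open>Fubini for the absolutely convergent double sum, each row being evaluated by the
  expansion of 1 / sin^2. Only the nonvanishing of Im (\<omega>2 / \<omega>1) enters, so both orders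
  of the periods are covered.\<close>

lemma has_sum_modified_weierstrass_rows:
  assumes z: "z \<notin> shifted_lattice \<omega>1 \<omega>2"
  shows "((\<lambda>n::int. 1 / (sin ((z - half_period \<omega>1 \<omega>2 - \<omega>2 * of_int n) * of_real pi / \<omega>1))\<^sup>2
                   - 1 / (sin ((half_period \<omega>1 \<omega>2 + \<omega>2 * of_int n) * of_real pi / \<omega>1))\<^sup>2)
          has_sum \<omega>1\<^sup>2 / (of_real pi)\<^sup>2 * modified_weierstrass \<omega>1 \<omega>2 z) UNIV"
proof -
  let ?h = "half_period \<omega>1 \<omega>2"
  let ?a = "\<lambda>(n::int, m::int). ?h + of_int n * \<omega>2 + of_int m * \<omega>1"
  let ?f = "\<lambda>(n, m). 1 / (z - ?a (n, m))\<^sup>2 - 1 / (?a (n, m))\<^sup>2"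
  let ?s = "\<lambda>x. 1 / (sin (x * of_real pi / \<omega>1))\<^sup>2"
  have w1: "\<omega>1 \<noteq> 0" using indep by auto
  have "(?f has_sum infsum ?f UNIV) UNIV"
    using summable_on_shifted_lattice[of z] by simp
  moreover have "infsum ?f UNIV = modified_weierstrass \<omega>1 \<omega>2 z"
    unfolding modified_weierstrass_def shifted_lattice_alt
    by (subst infsum_reindex[OF inj_shifted_lattice_point]) (simp add: o_def case_prod_unfold)
  ultimately have total: "(?f has_sum modified_weierstrass \<omega>1 \<omega>2 z) (UNIV \<times> UNIV)"
    by simp
  have row: "((\<lambda>m. ?f (n, m)) has_sum (of_real pi)\<^sup>2 / \<omega>1\<^sup>2 * (?s (z - ?h - \<omega>2 * of_int n) - ?s (?h + \<omega>2 * of_int n))) UNIV"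
    for n
  proof -
    \<comment> \<open>One formula for both parts of the term: y = z gives 1 / (z - a)^2 and y = 0
      gives 1 / a^2.\<close>
    have "((\<lambda>m. 1 / (?h + of_int n * \<omega>2 - y + of_int m * \<omega>1)\<^sup>2) has_sum
            (of_real pi)\<^sup>2 / \<omega>1\<^sup>2 * ?s (?h + of_int n * \<omega>2 - y)) UNIV"
      if "y \<notin> shifted_lattice \<omega>1 \<omega>2" for y
      by (rule has_sum_csc_squared_scaled[OF half_row_not_Ints[OF that]])
    from has_sum_add[OF this[OF z] has_sum_uminusI[OF this[OF zero_notin_shifted_lattice]]]
    have "((\<lambda>m. 1 / (?h + of_int n * \<omega>2 - z + of_int m * \<omega>1)\<^sup>2 - 1 / (?h + of_int n * \<omega>2 + of_int m * \<omega>1)\<^sup>2) has_sum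
            (of_real pi)\<^sup>2 / \<omega>1\<^sup>2 * (?s (?h + of_int n * \<omega>2 - z) - ?s (?h + of_int n * \<omega>2))) UNIV"
      by (simp add: algebra_simps)
    moreover have "(?h + of_int n * \<omega>2 - z + of_int m * \<omega>1)\<^sup>2 = (z - (?h + of_int n * \<omega>2 + of_int m * \<omega>1))\<^sup>2" for m
      by (simp add: power2_eq_square algebra_simps)
    moreover have "?s (?h + of_int n * \<omega>2 - z) = ?s (z - ?h - \<omega>2 * of_int n)"
    proof -
      have "(?h + of_int n * \<omega>2 - z) * of_real pi / \<omega>1 = - ((z - ?h - \<omega>2 * of_int n) * of_real pi / \<omega>1)"
        using w1 by (simp add: field_simps)
      then show ?thesis by (simp only: sin_minus power2_minus)
    qed
    ultimately show ?thesis by (simp add: mult.commute)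
  qed
  have "((\<lambda>n. (of_real pi)\<^sup>2 / \<omega>1\<^sup>2 * (?s (z - ?h - \<omega>2 * of_int n) - ?s (?h + \<omega>2 * of_int n)))
      has_sum modified_weierstrass \<omega>1 \<omega>2 z) UNIV"
    using has_sum_SigmaD[OF total row] by simp
  from has_sum_cmult_right[OF this, of "\<omega>1\<^sup>2 / (of_real pi)\<^sup>2"]
  show ?thesis using w1 by simp
qed

end

section \<open>Geometric and Lambert series\<close>

lemma has_sum_geometric:
  fixes x :: complex
  assumes "norm x < 1"
  shows "((\<lambda>n::nat. x ^ n) has_sum 1 / (1 - x)) UNIV"
  using assms by (intro norm_summable_imp_has_sum geometric_sums)
    (simp add: norm_power summable_geometric)

lemma summable_Suc_power:
  fixes r :: real
  assumes "0 \<le> r" "r < 1"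
  shows "summable (\<lambda>k. real (Suc k) * r ^ Suc k)"
  using summable_mult[OF sums_summable[OF geometric_deriv_sums[of r]], of r] assms
  by (simp add: algebra_simps)

lemma has_sum_geometric_deriv:
  fixes x :: complex
  assumes "norm x < 1"
  shows "((\<lambda>k. of_nat (Suc k) * x ^ Suc k) has_sum x / (1 - x)\<^sup>2) UNIV"
proof (rule norm_summable_imp_has_sum)
  show "(\<lambda>k. of_nat (Suc k) * x ^ Suc k) sums (x / (1 - x)\<^sup>2)"
    using sums_mult[OF geometric_deriv_sums[OF assms], of x] by (simp add: algebra_simps)
  show "summable (\<lambda>k. norm (of_nat (Suc k) * x ^ Suc k))"
    using summable_Suc_power[of "norm x"] assms by (simp add: norm_mult norm_power del: of_nat_Suc)
qed

text \<open>With E = exp (i pi w), sin (pi w) = (E - 1/E) / (2 i). The right-hand side has the shape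
  x / (1 - x)^2 of \<open>has_sum_geometric_deriv\<close>, with x = E^2.\<close>

lemma csc_squared_eq_exp:
  fixes w :: complex
  assumes "exp (2 * \<i> * of_real pi * w) \<noteq> 1"
  shows "1 / (sin (of_real pi * w))\<^sup>2 = - 4 * (exp (2 * \<i> * of_real pi * w) / (1 - exp (2 * \<i> * of_real pi * w))\<^sup>2)"
proof -
  define E where "E = exp (\<i> * of_real pi * w)"
  have E: "E \<noteq> 0" "exp (2 * \<i> * of_real pi * w) = E\<^sup>2"
    by (simp_all add: E_def mult_ac flip: exp_double)
  have "sin (of_real pi * w) = (E - 1 / E) / (2 * \<i>)"
    by (simp add: sin_exp_eq E_def exp_minus inverse_eq_divide mult_ac)
  also have "\<dots> = (E\<^sup>2 - 1) / (2 * \<i> * E)"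
    using E by (simp add: field_simps power2_eq_square)
  finally have "(sin (of_real pi * w))\<^sup>2 = - ((1 - E\<^sup>2)\<^sup>2 / (4 * E\<^sup>2))"
    by (simp add: power_divide power_mult_distrib power2_commute)
  then show ?thesis using E by simp
qed

text \<open>Both statements on \<open>S\<close> evaluate the absolutely convergent double series
  of \<open>k p\<^sup>k q\<^bsup>k(2n+1)\<^esup>\<close> over \<open>k \<ge> 1\<close>, \<open>n \<ge> 0\<close>.\<close>

lemma lambert_series_swap:
  fixes p q :: complex
  assumes pq: "norm (p * q) < 1" and q: "norm q < 1"
  obtains S where
    "((\<lambda>n. p * q ^ (2 * n + 1) / (1 - p * q ^ (2 * n + 1))\<^sup>2) has_sum S) UNIV"
    "((\<lambda>k. of_nat (Suc k) * p ^ Suc k * (q ^ Suc k / (1 - (q ^ Suc k)\<^sup>2))) has_sum S) UNIV"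
proof -
  define f where "f = (\<lambda>(n::nat, k::nat). of_nat (Suc k) * (p * q ^ (2 * n + 1)) ^ Suc k)"
  have q2: "norm (q\<^sup>2) < 1"
    using q by (simp add: norm_power power_less_one_iff)
  have "(\<lambda>(n, k). norm (q\<^sup>2) ^ n * (real (Suc k) * norm (p * q) ^ Suc k)) summable_on UNIV \<times> UNIV"
    using summable_Suc_power[of "norm (p * q)"] pq q2
    by (intro summable_on_Times_mult_real)
       (auto simp: summable_on_UNIV_nonneg_real_iff summable_geometric simp del: norm_power norm_mult)
  moreover have "norm (f (n, k)) \<le> norm (q\<^sup>2) ^ n * (real (Suc k) * norm (p * q) ^ Suc k)" for n k
  proof -
    \<comment> \<open>p may lie outside the unit disc, so it stays paired with one factor q; the
      rest is a power of q^2.\<close>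
    have *: "p * q ^ (2 * n + 1) = (p * q) * (q\<^sup>2) ^ n"
      by (simp add: power_mult)
    have "norm (f (n, k)) = real (Suc k) * (norm (p * q) ^ Suc k * norm ((q\<^sup>2) ^ n) ^ Suc k)"
      unfolding f_def prod.case *
      by (simp only: norm_mult norm_of_nat power_mult_distrib norm_power[where n = "Suc k"])
    \<comment> \<open>Lowering the exponent \<open>Suc k\<close> to 1 decouples n from k.\<close>
    also have "\<dots> \<le> real (Suc k) * (norm (p * q) ^ Suc k * norm ((q\<^sup>2) ^ n) ^ 1)"
      using q2 by (intro mult_left_mono power_decreasing) (auto simp: norm_power power_le_one)
    finally show ?thesis
      by (simp add: norm_power mult_ac del: of_nat_Suc power_Suc)
  qed
  ultimately have "(\<lambda>x. norm (f x)) summable_on UNIV \<times> UNIV"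
    using summable_on_comparison_test[where g = "\<lambda>x. norm (f x)"] by force
  then have "f summable_on UNIV \<times> UNIV" by (rule abs_summable_summable)
  then obtain S where S: "(f has_sum S) (UNIV \<times> UNIV)" by (auto simp: summable_on_def)
  have "((\<lambda>n. p * q ^ (2 * n + 1) / (1 - p * q ^ (2 * n + 1))\<^sup>2) has_sum S) UNIV"
  proof (rule has_sum_SigmaD[OF S])
    fix n :: nat
    have "norm (p * q ^ (2 * n + 1)) = norm (p * q) * norm (q\<^sup>2) ^ n"
      by (simp add: norm_mult norm_power power_mult)
    also have "\<dots> \<le> norm (p * q)"
      using q2 by (intro mult_left_le) (auto intro: power_le_one)
    finally have "norm (p * q ^ (2 * n + 1)) < 1" using pq by linarith
    from has_sum_geometric_deriv[OF this]
    show "((\<lambda>k. f (n, k)) has_sum p * q ^ (2 * n + 1) / (1 - p * q ^ (2 * n + 1))\<^sup>2) UNIV"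
      by (simp add: f_def)
  qed
  moreover have "((\<lambda>k. of_nat (Suc k) * p ^ Suc k * (q ^ Suc k / (1 - (q ^ Suc k)\<^sup>2))) has_sum S) UNIV"
  proof (rule has_sum_SigmaD)
    show "((\<lambda>(k, n). f (n, k)) has_sum S) (UNIV \<times> UNIV)"
      using S by (rule has_sum_swap[THEN iffD1])
    \<comment> \<open>For fixed k the sum over n is geometric with ratio
      \<open>(q ^ Suc k)\<^sup>2\<close>.\<close>
    fix k :: nat
    have "norm ((q ^ Suc k)\<^sup>2) < 1"
      using q by (simp add: norm_power power_less_one_iff flip: power_mult del: power_Suc)
    from has_sum_cmult_right[OF has_sum_geometric[OF this], of "of_nat (Suc k) * p ^ Suc k * q ^ Suc k"]
    have "((\<lambda>n. of_nat (Suc k) * p ^ Suc k * q ^ Suc k * ((q ^ Suc k)\<^sup>2) ^ n) has_sum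
        of_nat (Suc k) * p ^ Suc k * (q ^ Suc k / (1 - (q ^ Suc k)\<^sup>2))) UNIV"
      by simp
    moreover have "f (n, k) = of_nat (Suc k) * p ^ Suc k * q ^ Suc k * ((q ^ Suc k)\<^sup>2) ^ n" for n
    proof -
      have "(q ^ (2 * n + 1)) ^ Suc k = q ^ (Suc k + Suc k * 2 * n)"
        by (simp only: flip: power_mult) (simp add: algebra_simps)
      also have "\<dots> = q ^ Suc k * ((q ^ Suc k)\<^sup>2) ^ n"
        by (simp only: power_mult power_add)
      finally show ?thesis
        by (simp only: f_def prod.case power_mult_distrib mult.assoc)
    qed
    ultimately show "((\<lambda>n. case (k, n) of (k, n) \<Rightarrow> f (n, k)) has_sum
        of_nat (Suc k) * p ^ Suc k * (q ^ Suc k / (1 - (q ^ Suc k)\<^sup>2))) UNIV"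
      by simp
  qed
  ultimately show ?thesis using that by blast
qed


section \<open>Fourier series of the row sums in a strip\<close>

lemma norm_exp_i_pi: "norm (exp (2 * \<i> * of_real pi * w)) = exp (- 2 * pi * Im w)"
  by simp

text \<open>The upper bound on Im u puts all arguments w of these rows in the upper half-plane,
  where exp (2 pi i w) = p q^(2 n + 1) lies in the unit disc and the Lambert series applies. The
  remaining rows will come from - u.\<close>

lemma has_sum_csc_squared_half_rows:
  fixes u \<tau> :: complex
  assumes u: "Im u < Im \<tau> / 2" and \<tau>: "Im \<tau> > 0"
  defines "p \<equiv> - exp (- 2 * \<i> * of_real pi * u)" and "q \<equiv> exp (\<i> * of_real pi * \<tau>)"
  obtains S where
    "((\<lambda>n::nat. 1 / (sin (of_real pi * (1 / 2 + \<tau> / 2 + of_nat n * \<tau> - u)))\<^sup>2) has_sum - 4 * S) UNIV"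
    "((\<lambda>k. of_nat (Suc k) * p ^ Suc k * (q ^ Suc k / (1 - (q ^ Suc k)\<^sup>2))) has_sum S) UNIV"
proof -
  have "norm (p * q) = norm (exp (2 * \<i> * of_real pi * (\<tau> / 2 - u)))"
    by (simp add: p_def q_def algebra_simps flip: exp_add)
  then have pq: "norm (p * q) < 1"
    using u by (simp only: norm_exp_i_pi) simp
  have q: "norm q < 1"
    using \<tau> by (simp add: q_def)
  obtain S where S: "((\<lambda>n. p * q ^ (2 * n + 1) / (1 - p * q ^ (2 * n + 1))\<^sup>2) has_sum S) UNIV"
    "((\<lambda>k. of_nat (Suc k) * p ^ Suc k * (q ^ Suc k / (1 - (q ^ Suc k)\<^sup>2))) has_sum S) UNIV"
    using lambert_series_swap[OF pq q] by blast
  have "1 / (sin (of_real pi * (1 / 2 + \<tau> / 2 + of_nat n * \<tau> - u)))\<^sup>2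
      = - 4 * (p * q ^ (2 * n + 1) / (1 - p * q ^ (2 * n + 1))\<^sup>2)" for n :: nat
  proof -
    let ?w = "1 / 2 + \<tau> / 2 + of_nat n * \<tau> - u"
    \<comment> \<open>The summand 1/2 contributes exp (i pi) = - 1, the sign in \<open>p\<close>;
      \<tau>/2 + n \<tau> contributes 2 n + 1 factors \<open>q\<close>.\<close>
    have "2 * \<i> * of_real pi * ?w = \<i> * of_real pi + (- 2 * \<i> * of_real pi * u)
        + of_nat (2 * n + 1) * (\<i> * of_real pi * \<tau>)"
      by (simp add: algebra_simps)
    then have E: "exp (2 * \<i> * of_real pi * ?w) = p * q ^ (2 * n + 1)"
      by (simp only: exp_add exp_of_nat_mult p_def q_def exp_pi_i') simp
    have "Im ?w > 0"
    proof -
      have "Im ?w = Im \<tau> / 2 + real n * Im \<tau> - Im u" by simp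
      moreover have "0 \<le> real n * Im \<tau>" using \<tau> by simp
      ultimately show ?thesis using u by linarith
    qed
    then have "norm (exp (2 * \<i> * of_real pi * ?w)) < 1"
      by (simp only: norm_exp_i_pi) simp
    then have "exp (2 * \<i> * of_real pi * ?w) \<noteq> 1" by (metis norm_one less_irrefl)
    from csc_squared_eq_exp[OF this] show ?thesis unfolding E .
  qed
  then show ?thesis
    using that[of S] has_sum_cmult_right[OF S(1), of "- 4"] S(2) by simp
qed

text \<open>With Q = exp (i (k + 1) pi \<tau>), Q / (1 - Q^2) = 1 / (1/Q - Q) and Q - 1/Q is 2 i
  times the sine; |Q| < 1 keeps the denominators nonzero.\<close>

lemma lambert_coefficient_eq:
  fixes \<tau> :: complex
  assumes "Im \<tau> > 0"
  defines "q \<equiv> exp (\<i> * of_real pi * \<tau>)"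
  shows "q ^ Suc k / (1 - (q ^ Suc k)\<^sup>2) = \<i> / (2 * sin (of_nat (Suc k) * of_real pi * \<tau>))"
proof -
  define Q where "Q = q ^ Suc k"
  have Q: "Q = exp (\<i> * (of_nat (Suc k) * of_real pi * \<tau>))"
    by (simp only: Q_def q_def mult_ac flip: exp_of_nat_mult)
  have Q0: "Q \<noteq> 0" by (simp add: Q)
  have "norm q < 1" using assms by simp
  then have "norm (Q\<^sup>2) < 1"
    by (simp add: Q_def norm_power power_less_one_iff del: power_Suc)
  then have "Q\<^sup>2 \<noteq> 1" by auto
  moreover have "sin (of_nat (Suc k) * of_real pi * \<tau>) = (Q - 1 / Q) / (2 * \<i>)"
    by (simp add: sin_exp_eq Q exp_minus inverse_eq_divide mult_ac del: of_nat_Suc)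
  ultimately have "Q / (1 - Q\<^sup>2) = \<i> / (2 * sin (of_nat (Suc k) * of_real pi * \<tau>))"
    using Q0 by (simp add: divide_simps) (auto simp: power2_eq_square algebra_simps)
  then show ?thesis by (simp add: Q_def)
qed

text \<open>Rows n \<ge> 0 are expanded at u and rows n < 0 at - u; the conjugate exponentials add
  up to cosines.\<close>

lemma has_sum_csc_squared_strip:
  fixes u \<tau> :: complex
  assumes u: "\<bar>Im u\<bar> < Im \<tau> / 2"
  obtains S where
    "((\<lambda>n::int. 1 / (sin (of_real pi * (u - 1 / 2 - \<tau> / 2 - of_int n * \<tau>)))\<^sup>2) has_sum - 4 * \<i> * S) UNIV"
    "(\<lambda>k. (-1) ^ Suc k * of_nat (Suc k) / sin (of_nat (Suc k) * of_real pi * \<tau>)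
        * cos (2 * of_nat (Suc k) * of_real pi * u)) sums S"
proof -
  have \<tau>: "Im \<tau> > 0" and u1: "Im u < Im \<tau> / 2" and u2: "Im (- u) < Im \<tau> / 2"
    using u by auto
  let ?p = "\<lambda>u. - exp (- 2 * \<i> * of_real pi * u)" and ?q = "exp (\<i> * of_real pi * \<tau>)"
  let ?c = "\<lambda>k. ?q ^ Suc k / (1 - (?q ^ Suc k)\<^sup>2)"
  let ?s = "\<lambda>w. 1 / (sin (of_real pi * w))\<^sup>2"
  let ?t = "\<lambda>k. (-1) ^ Suc k * of_nat (Suc k) / sin (of_nat (Suc k) * of_real pi * \<tau>)
        * cos (2 * of_nat (Suc k) * of_real pi * u)"
  obtain S1 where S1: "((\<lambda>n::nat. ?s (1 / 2 + \<tau> / 2 + of_nat n * \<tau> - u)) has_sum - 4 * S1) UNIV"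
    "((\<lambda>k. of_nat (Suc k) * ?p u ^ Suc k * ?c k) has_sum S1) UNIV"
    using has_sum_csc_squared_half_rows[OF u1 \<tau>] by blast
  obtain S2 where S2: "((\<lambda>n::nat. ?s (1 / 2 + \<tau> / 2 + of_nat n * \<tau> - (- u))) has_sum - 4 * S2) UNIV"
    "((\<lambda>k. of_nat (Suc k) * ?p (- u) ^ Suc k * ?c k) has_sum S2) UNIV"
    using has_sum_csc_squared_half_rows[OF u2 \<tau>] by blast
  have neg: "?s w = ?s (- w)" for w
    by simp
  have "?s (u - 1 / 2 - \<tau> / 2 - of_int (int n) * \<tau>) = ?s (1 / 2 + \<tau> / 2 + of_nat n * \<tau> - u)" for n
    by (subst neg) (simp add: algebra_simps)
  then have A: "((\<lambda>n. ?s (u - 1 / 2 - \<tau> / 2 - of_int (int n) * \<tau>)) has_sum - 4 * S1) UNIV"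
    using S1(1) by presburger
  \<comment> \<open>Row - n - 1 is row n at - u, shifted by - 1; the shift only changes the sign of
    the sine.\<close>
  have "?s (u - 1 / 2 - \<tau> / 2 - of_int (- int n - 1) * \<tau>) = ?s (1 / 2 + \<tau> / 2 + of_nat n * \<tau> - (- u))" for n
  proof -
    have "u - 1 / 2 - \<tau> / 2 - of_int (- int n - 1) * \<tau> = 1 / 2 + \<tau> / 2 + of_nat n * \<tau> - (- u) - 1"
      by (simp add: algebra_simps)
    moreover have "sin (of_real pi * (w - 1)) = - sin (of_real pi * w)" for w :: complex
      by (simp add: right_diff_distrib sin_diff)
    ultimately show ?thesis by (simp only: power2_minus)
  qed
  then have B: "((\<lambda>n. ?s (u - 1 / 2 - \<tau> / 2 - of_int (- int n - 1) * \<tau>)) has_sum - 4 * S2) UNIV"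
    using S2(1) by presburger
  have "((\<lambda>n::int. ?s (u - 1 / 2 - \<tau> / 2 - of_int n * \<tau>)) has_sum - 4 * S1 + - 4 * S2) UNIV"
    by (rule has_sum_int_split[OF A B])
  \<comment> \<open>The factor - i is chosen because - i times 2 times i / (2 sin) is 1 / sin, the
    coefficient in \<open>?t\<close>.\<close>
  then have C: "((\<lambda>n::int. ?s (u - 1 / 2 - \<tau> / 2 - of_int n * \<tau>)) has_sum - 4 * \<i> * (- \<i> * (S1 + S2))) UNIV"
    by (simp add: algebra_simps)
  have "- \<i> * (of_nat (Suc k) * ?p u ^ Suc k * ?c k + of_nat (Suc k) * ?p (- u) ^ Suc k * ?c k) = ?t k" for k
  proof -
    let ?x = "2 * of_nat (Suc k) * of_real pi * u"
    \<comment> \<open>Writing the sign as a factor lets the power distribute over it.\<close>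
    have "- exp v = (-1) * exp v" for v :: complex by simp
    then have P: "?p v ^ Suc k = (-1) ^ Suc k * exp (- (\<i> * (2 * of_nat (Suc k) * of_real pi * v)))" for v
      by (simp only: power_mult_distrib flip: exp_of_nat_mult) (simp add: mult_ac)
    have "?p u ^ Suc k + ?p (- u) ^ Suc k = (-1) ^ Suc k * (2 * cos ?x)"
      unfolding P by (simp add: cos_exp_eq algebra_simps del: of_nat_Suc power_Suc)
    then have "of_nat (Suc k) * ?p u ^ Suc k * ?c k + of_nat (Suc k) * ?p (- u) ^ Suc k * ?c k
      = of_nat (Suc k) * ((-1) ^ Suc k * (2 * cos ?x)) * ?c k"
      by (simp only: flip: distrib_left distrib_right)
    then show ?thesis
      unfolding lambert_coefficient_eq[OF \<tau>] by (simp add: mult_ac del: of_nat_Suc power_Suc)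
  qed
  then have "(?t has_sum - \<i> * (S1 + S2)) UNIV"
    using has_sum_cmult_right[OF has_sum_add[OF S1(2) S2(2)], of "- \<i>"] by presburger
  with C show ?thesis
    by (intro that[of "- \<i> * (S1 + S2)"] has_sum_imp_sums)
qed

section \<open>The modified Weierstrass function in the strip\<close>

text \<open>At a pole Im (z / \<omega>1) is (n + 1/2) Im (\<omega>2 / \<omega>1), and |n + 1/2|
  \<ge> 1/2. Hence the row formula holds on the whole strip.\<close>

lemma strip_notin_shifted_lattice:
  assumes "\<bar>Im (z / \<omega>1)\<bar> < 1 / 2 * Im (\<omega>2 / \<omega>1)"
  shows "z \<notin> shifted_lattice \<omega>1 \<omega>2"
proof
  assume "z \<in> shifted_lattice \<omega>1 \<omega>2"
  then obtain n m :: int where "z = of_real (of_int m + 1 / 2) * \<omega>1 + of_real (of_int n + 1 / 2) * \<omega>2"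
    unfolding mem_shifted_lattice_iff by blast
  moreover have "\<omega>1 \<noteq> 0" using assms by auto
  ultimately have "z / \<omega>1 = of_real (of_int m + 1 / 2) + of_real (of_int n + 1 / 2) * (\<omega>2 / \<omega>1)"
    by (simp add: add_divide_distrib)
  then have Im: "Im (z / \<omega>1) = (of_int n + 1 / 2) * Im (\<omega>2 / \<omega>1)"
    by (simp only: plus_complex.sel Im_complex_of_real Re_complex_of_real times_complex.sel)
  have "1 / 2 \<le> \<bar>real_of_int n + 1 / 2\<bar>"
  proof (cases "n \<ge> 0")
    case False
    then have "real_of_int n \<le> - 1" by linarith
    then show ?thesis by simp
  qed simp
  then have "1 / 2 * \<bar>Im (\<omega>2 / \<omega>1)\<bar> \<le> \<bar>Im (z / \<omega>1)\<bar>"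
    unfolding Im abs_mult by (rule mult_right_mono) simp
  with assms show False by linarith
qed

text \<open>The strip expansion at u = z / \<omega>1 and at u = 0 sums the two terms of each row
  separately; at 0 every cosine is 1. Uniqueness of the sum compares the result with the row
  formula.\<close>

lemma modified_weierstrass_fourier:
  fixes \<omega>1 \<omega>2 z :: complex
  assumes z: "\<bar>Im (z / \<omega>1)\<bar> < 1 / 2 * Im (\<omega>2 / \<omega>1)"
  obtains S S0 where
    "(\<lambda>n. (-1) ^ Suc n * of_nat (Suc n) / sin (of_nat (Suc n) * of_real pi * \<omega>2 / \<omega>1)
        * cos (2 * of_nat (Suc n) * of_real pi * (z / \<omega>1))) sums S"
    "(\<lambda>n. (-1) ^ Suc n * of_nat (Suc n) / sin (of_nat (Suc n) * of_real pi * \<omega>2 / \<omega>1)) sums S0"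
    "modified_weierstrass \<omega>1 \<omega>2 z = - 4 * \<i> * (of_real pi)\<^sup>2 / \<omega>1\<^sup>2 * (S - S0)"
proof -
  let ?h = "half_period \<omega>1 \<omega>2" and ?\<tau> = "\<omega>2 / \<omega>1"
  let ?s = "\<lambda>x. 1 / (sin x)\<^sup>2"
  have w1: "\<omega>1 \<noteq> 0" and ind: "Im ?\<tau> \<noteq> 0" using z by auto
  have u: "\<bar>Im (z / \<omega>1)\<bar> < Im ?\<tau> / 2" and u0: "\<bar>Im 0\<bar> < Im ?\<tau> / 2" using z by auto
  obtain S where S: "((\<lambda>n::int. ?s (of_real pi * (z / \<omega>1 - 1 / 2 - ?\<tau> / 2 - of_int n * ?\<tau>))) has_sum - 4 * \<i> * S) UNIV"
    "(\<lambda>k. (-1) ^ Suc k * of_nat (Suc k) / sin (of_nat (Suc k) * of_real pi * ?\<tau>)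
        * cos (2 * of_nat (Suc k) * of_real pi * (z / \<omega>1))) sums S"
    using has_sum_csc_squared_strip[OF u] by blast
  obtain S0 where S0: "((\<lambda>n::int. ?s (of_real pi * (0 - 1 / 2 - ?\<tau> / 2 - of_int n * ?\<tau>))) has_sum - 4 * \<i> * S0) UNIV"
    "(\<lambda>k. (-1) ^ Suc k * of_nat (Suc k) / sin (of_nat (Suc k) * of_real pi * ?\<tau>)
        * cos (2 * of_nat (Suc k) * of_real pi * 0)) sums S0"
    using has_sum_csc_squared_strip[OF u0] by blast
  have "?s ((z - ?h - \<omega>2 * of_int n) * of_real pi / \<omega>1) - ?s ((?h + \<omega>2 * of_int n) * of_real pi / \<omega>1)
      = ?s (of_real pi * (z / \<omega>1 - 1 / 2 - ?\<tau> / 2 - of_int n * ?\<tau>))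
        - ?s (of_real pi * (0 - 1 / 2 - ?\<tau> / 2 - of_int n * ?\<tau>))" for n
  proof -
    have "(z - ?h - \<omega>2 * of_int n) * of_real pi / \<omega>1 = of_real pi * (z / \<omega>1 - 1 / 2 - ?\<tau> / 2 - of_int n * ?\<tau>)"
      and "(?h + \<omega>2 * of_int n) * of_real pi / \<omega>1 = - (of_real pi * (0 - 1 / 2 - ?\<tau> / 2 - of_int n * ?\<tau>))"
      using w1 by (simp_all add: half_period_def field_simps)
    then show ?thesis by (simp only: sin_minus power2_minus)
  qed
  moreover have "((\<lambda>n. ?s (of_real pi * (z / \<omega>1 - 1 / 2 - ?\<tau> / 2 - of_int n * ?\<tau>))
        - ?s (of_real pi * (0 - 1 / 2 - ?\<tau> / 2 - of_int n * ?\<tau>))) has_sum (- 4 * \<i> * S + - (- 4 * \<i> * S0))) UNIV"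
    using has_sum_add[OF S(1) has_sum_uminusI[OF S0(1)]] by simp
  ultimately have "\<omega>1\<^sup>2 / (of_real pi)\<^sup>2 * modified_weierstrass \<omega>1 \<omega>2 z = - 4 * \<i> * S + - (- 4 * \<i> * S0)"
    using has_sum_unique[OF has_sum_modified_weierstrass_rows[OF ind strip_notin_shifted_lattice[OF z]]]
    by presburger
  then have "modified_weierstrass \<omega>1 \<omega>2 z = - 4 * \<i> * (of_real pi)\<^sup>2 / \<omega>1\<^sup>2 * (S - S0)"
    using w1 by (simp add: field_simps)
  with S(2) S0(2) show ?thesis
    by (intro that[of S S0]) simp_all
qed

section \<open>Change of basis and assembly of the four formulas\<close>

lemma shifted_lattice_swap: "shifted_lattice \<omega>2 \<omega>1 = shifted_lattice \<omega>1 \<omega>2"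
proof -
  have "period_lattice \<omega>2 \<omega>1 = period_lattice \<omega>1 \<omega>2"
    unfolding period_lattice_def by (metis add.commute)
  then show ?thesis by (simp add: shifted_lattice_def half_period_def add.commute)
qed

text \<open>The half-period changes, but the set of half-integers is closed under negation: - (m +
  1/2) = (- m - 1) + 1/2. The inclusion for v = \<open>\<omega>1\<close> and v =
  \<open>- \<omega>1\<close> gives equality.\<close>

lemma shifted_lattice_minus_left: "shifted_lattice (- \<omega>1) \<omega>2 = shifted_lattice \<omega>1 \<omega>2"
proof -
  have sub: "shifted_lattice (- v) \<omega>2 \<subseteq> shifted_lattice v \<omega>2" for v
  proof
    fix x assume "x \<in> shifted_lattice (- v) \<omega>2"
    then obtain n m :: int where "x = of_real (of_int m + 1 / 2) * (- v) + of_real (of_int n + 1 / 2) * \<omega>2"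
      unfolding mem_shifted_lattice_iff by blast
    also have "\<dots> = of_real (of_int (- m - 1) + 1 / 2) * v + of_real (of_int n + 1 / 2) * \<omega>2"
      by (simp add: algebra_simps)
    finally show "x \<in> shifted_lattice v \<omega>2"
      unfolding mem_shifted_lattice_iff by blast
  qed
  from sub[of \<omega>1] sub[of "- \<omega>1"] show ?thesis by auto
qed

theorem mainTheorem3:
  fixes \<omega>1 \<omega>2 :: complex
  assumes "\<omega>1 \<noteq> 0" and "\<omega>2 \<noteq> 0" and "Im (\<omega>2 / \<omega>1) > 0"
  shows "(\<forall>z. \<bar>Im (z / \<omega>1)\<bar> < 1 / 2 * Im (\<omega>2 / \<omega>1) \<longrightarrow>
           summable (\<lambda>n. (-1) ^ Suc n * of_nat (Suc n) / sin (of_nat (Suc n) * of_real pi * \<omega>2 / \<omega>1) * cos (2 * of_nat (Suc n) * of_real pi * (z / \<omega>1)))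
         \<and> summable (\<lambda>n. (-1) ^ Suc n * of_nat (Suc n) / sin (of_nat (Suc n) * of_real pi * \<omega>2 / \<omega>1))
         \<and> modified_weierstrass \<omega>1 \<omega>2 z =
             - 4 * \<i> * (of_real pi)\<^sup>2 / \<omega>1\<^sup>2 *
               ((\<Sum>n. (-1) ^ Suc n * of_nat (Suc n) / sin (of_nat (Suc n) * of_real pi * \<omega>2 / \<omega>1) * cos (2 * of_nat (Suc n) * of_real pi * (z / \<omega>1)))
              - (\<Sum>n. (-1) ^ Suc n * of_nat (Suc n) / sin (of_nat (Suc n) * of_real pi * \<omega>2 / \<omega>1))))
       \<and> (\<forall>z. \<bar>Im (z / \<omega>2)\<bar> < - (1 / 2) * Im (\<omega>1 / \<omega>2) \<longrightarrow>
           summable (\<lambda>n. (-1) ^ Suc n * of_nat (Suc n) / sin (of_nat (Suc n) * of_real pi * \<omega>1 / \<omega>2) * cos (2 * of_nat (Suc n) * of_real pi * (z / \<omega>2)))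
         \<and> summable (\<lambda>n. (-1) ^ Suc n * of_nat (Suc n) / sin (of_nat (Suc n) * of_real pi * \<omega>1 / \<omega>2))
         \<and> modified_weierstrass \<omega>1 \<omega>2 z =
             4 * \<i> * (of_real pi)\<^sup>2 / \<omega>2\<^sup>2 *
               ((\<Sum>n. (-1) ^ Suc n * of_nat (Suc n) / sin (of_nat (Suc n) * of_real pi * \<omega>1 / \<omega>2) * cos (2 * of_nat (Suc n) * of_real pi * (z / \<omega>2)))
              - (\<Sum>n. (-1) ^ Suc n * of_nat (Suc n) / sin (of_nat (Suc n) * of_real pi * \<omega>1 / \<omega>2))))
       \<and> (\<forall>z. z \<notin> shifted_lattice \<omega>1 \<omega>2 \<longrightarrow>
           (\<lambda>n::int. 1 / (sin ((z - half_period \<omega>1 \<omega>2 - \<omega>2 * of_int n) * of_real pi / \<omega>1))\<^sup>2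
                   - 1 / (sin ((half_period \<omega>1 \<omega>2 + \<omega>2 * of_int n) * of_real pi / \<omega>1))\<^sup>2) summable_on UNIV
         \<and> modified_weierstrass \<omega>1 \<omega>2 z =
             (of_real pi)\<^sup>2 / \<omega>1\<^sup>2 *
               (\<Sum>\<^sub>\<infinity>n::int.
                     1 / (sin ((z - half_period \<omega>1 \<omega>2 - \<omega>2 * of_int n) * of_real pi / \<omega>1))\<^sup>2
                   - 1 / (sin ((half_period \<omega>1 \<omega>2 + \<omega>2 * of_int n) * of_real pi / \<omega>1))\<^sup>2))
       \<and> (\<forall>z. z \<notin> shifted_lattice \<omega>1 \<omega>2 \<longrightarrow>
           (\<lambda>n::int. 1 / (sin ((z - half_period \<omega>1 \<omega>2 - \<omega>1 * of_int n) * of_real pi / \<omega>2))\<^sup>2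
                   - 1 / (sin ((half_period \<omega>1 \<omega>2 + \<omega>1 * of_int n) * of_real pi / \<omega>2))\<^sup>2) summable_on UNIV
         \<and> modified_weierstrass \<omega>1 \<omega>2 z =
             (of_real pi)\<^sup>2 / \<omega>2\<^sup>2 *
               (\<Sum>\<^sub>\<infinity>n::int.
                     1 / (sin ((z - half_period \<omega>1 \<omega>2 - \<omega>1 * of_int n) * of_real pi / \<omega>2))\<^sup>2
                   - 1 / (sin ((half_period \<omega>1 \<omega>2 + \<omega>1 * of_int n) * of_real pi / \<omega>2))\<^sup>2))"
    (is "(\<forall>z. _ z \<longrightarrow> ?P1 z) \<and> (\<forall>z. _ z \<longrightarrow> ?P2 z) \<and> (\<forall>z. _ z \<longrightarrow> ?P3 z) \<and> (\<forall>z. _ z \<longrightarrow> ?P4 z)")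
proof -
  have ind: "Im (\<omega>2 / \<omega>1) \<noteq> 0" using assms(3) by simp
  have ind': "Im (\<omega>1 / \<omega>2) \<noteq> 0"
  proof -
    have "\<omega>1 / \<omega>2 = inverse (\<omega>2 / \<omega>1)" by simp
    then show ?thesis using ind by (simp only: inverse_complex.sel) (auto simp: sum_power2_eq_zero_iff)
  qed
  have swap: "modified_weierstrass \<omega>2 \<omega>1 = modified_weierstrass \<omega>1 \<omega>2" "half_period \<omega>2 \<omega>1 = half_period \<omega>1 \<omega>2"
    by (simp_all add: fun_eq_iff modified_weierstrass_def shifted_lattice_swap half_period_def add.commute)
  \<comment> \<open>The Fourier lemma needs a positively oriented basis, hence (\<omega>2, -
    \<omega>1); for the row formula (\<omega>2, \<omega>1) suffices. The function depends on the
    shifted lattice alone.\<close>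
  have minus: "modified_weierstrass \<omega>2 (- \<omega>1) = modified_weierstrass \<omega>1 \<omega>2"
    by (simp add: fun_eq_iff modified_weierstrass_def shifted_lattice_swap[of \<omega>2] shifted_lattice_minus_left)
  have rows1: "(\<lambda>n::int. 1 / (sin ((z - half_period \<omega>1 \<omega>2 - \<omega>2 * of_int n) * of_real pi / \<omega>1))\<^sup>2
                   - 1 / (sin ((half_period \<omega>1 \<omega>2 + \<omega>2 * of_int n) * of_real pi / \<omega>1))\<^sup>2) summable_on UNIV
         \<and> modified_weierstrass \<omega>1 \<omega>2 z =
             (of_real pi)\<^sup>2 / \<omega>1\<^sup>2 *
               (\<Sum>\<^sub>\<infinity>n::int.
                     1 / (sin ((z - half_period \<omega>1 \<omega>2 - \<omega>2 * of_int n) * of_real pi / \<omega>1))\<^sup>2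
                   - 1 / (sin ((half_period \<omega>1 \<omega>2 + \<omega>2 * of_int n) * of_real pi / \<omega>1))\<^sup>2)"
    if "Im (\<omega>2 / \<omega>1) \<noteq> 0" "z \<notin> shifted_lattice \<omega>1 \<omega>2" for \<omega>1 \<omega>2 z :: complex
  proof -
    have "\<omega>1 \<noteq> 0" using that(1) by auto
    with has_sum_modified_weierstrass_rows[OF that] show ?thesis
      by (auto simp: has_sum_iff)
  qed
  show ?thesis
  proof (intro conjI[OF _ conjI[OF _ conjI]] allI impI)
    fix z assume "\<bar>Im (z / \<omega>1)\<bar> < 1 / 2 * Im (\<omega>2 / \<omega>1)"
    then show "?P1 z"
      by (rule modified_weierstrass_fourier) (simp only: sums_iff simp_thms)
  next
    fix z assume "\<bar>Im (z / \<omega>2)\<bar> < - (1 / 2) * Im (\<omega>1 / \<omega>2)"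
    then have "\<bar>Im (z / \<omega>2)\<bar> < 1 / 2 * Im (- \<omega>1 / \<omega>2)" by simp
    then obtain S S0 where S: 
      "(\<lambda>n. (-1) ^ Suc n * of_nat (Suc n) / sin (of_nat (Suc n) * of_real pi * (- \<omega>1) / \<omega>2)
          * cos (2 * of_nat (Suc n) * of_real pi * (z / \<omega>2))) sums S"
      "(\<lambda>n. (-1) ^ Suc n * of_nat (Suc n) / sin (of_nat (Suc n) * of_real pi * (- \<omega>1) / \<omega>2)) sums S0"
      "modified_weierstrass \<omega>2 (- \<omega>1) z = - 4 * \<i> * (of_real pi)\<^sup>2 / \<omega>2\<^sup>2 * (S - S0)"
      by (rule modified_weierstrass_fourier)
    \<comment> \<open>Oddness of the sine flips both series, turning the prefactor - 4 i into 4
      i.\<close>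
    have neg: "a / sin (b * (- \<omega>1) / \<omega>2) = - (a / sin (b * \<omega>1 / \<omega>2))" for a b
      by simp
    have "(\<lambda>n. (-1) ^ Suc n * of_nat (Suc n) / sin (of_nat (Suc n) * of_real pi * \<omega>1 / \<omega>2)
          * cos (2 * of_nat (Suc n) * of_real pi * (z / \<omega>2))) sums - S"
      "(\<lambda>n. (-1) ^ Suc n * of_nat (Suc n) / sin (of_nat (Suc n) * of_real pi * \<omega>1 / \<omega>2)) sums - S0"
      using sums_minus[OF S(1)] sums_minus[OF S(2)] unfolding neg by simp_all
    moreover have "modified_weierstrass \<omega>1 \<omega>2 z = 4 * \<i> * (of_real pi)\<^sup>2 / \<omega>2\<^sup>2 * (- S - - S0)"
      using S(3) unfolding minus by (simp add: algebra_simps diff_divide_distrib)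
    ultimately show "?P2 z"
      by (simp only: sums_iff simp_thms)
  next
    fix z assume "z \<notin> shifted_lattice \<omega>1 \<omega>2"
    from rows1[OF ind this] show "?P3 z" .
  next
    fix z assume "z \<notin> shifted_lattice \<omega>1 \<omega>2"
    then have "z \<notin> shifted_lattice \<omega>2 \<omega>1" by (simp add: shifted_lattice_swap)
    from rows1[OF ind' this] show "?P4 z" by (simp only: swap)
  qed
qed

end
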